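(* Let $n$ and $r$ be integers with $1\le r\le n-1$, and let $\mathcal{L}_m$, $m^j_{n,r}$, $\sigma^j_{n,r}$, $\lambda^j_{n,r}$ ($1\le j\le 2^r$) be as defined in the context. Then $$\mathcal{L}_n(x)=\left(\sum_{j=1}^{2^r}\sigma^j_{n,r}\,\frac{\mathcal{L}_{m^j_{n,r}}(x)}{\lambda^j_{n,r}}\right)^{(r)}=\left(\frac{(-1)^r\mathcal{L}_{n-r}(x)}{\lambda^1_{n,r}}+\frac{(-1)^{r-1}\mathcal{L}_{n-r+2}(x)}{\lambda^2_{n,r}}+\cdots-\frac{\mathcal{L}_{n+r-2}(x)}{\lambda^{2^r-1}_{n,r}}+\frac{\mathcal{L}_{n+r}(x)}{\lambda^{2^r}_{n,r}}\right)^{(r)},$$ where $$\lambda^j_{n,r}=\prod_{i=1}^{r}(2n-2i+3)\ \text{ for } j=1,2,\qquad \lambda^j_{n,r}=\prod_{i=1}^{r}(2n+2i-1)\ \text{ for } j=2^r-1,\,2^r.$$ Moreover, for $1\le j\le 2^{r-1}$, $$\lambda^1_{n,r}=\lambda^2_{n,r}\le\lambda^{2j-1}_{n,r}=\lambda^{2j}_{n,r}\le\lambda^{2^r-1}_{n,r}=\lambda^{2^r}_{n,r}.$$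
   Context: $L_m$ denotes the Legendre polynomial of degree $m$ (normalized by $L_m(1)=1$). For $m\ge1$, $\mathcal{L}_m(x):=\frac{(1-x^2)L_m'(x)}{m(m+1)}$. The superscript $(r)$ on a parenthesized function denotes its $r$-th derivative in $x$. For integers $n\ge1$ and $0\le r\le n-1$, the indices $m^j_{n,r}$, signs $\sigma^j_{n,r}$ and numbers $\lambda^j_{n,r}$, $1\le j\le 2^r$, are defined recursively by $m^1_{n,0}=n$, $\sigma^1_{n,0}=1$, $\lambda^1_{n,0}=1$, and, for $1\le j\le 2^r$ and $r+1\le n-1$, $$m^{2j-1}_{n,r+1}=m^j_{n,r}-1,\quad m^{2j}_{n,r+1}=m^j_{n,r}+1,\quad \sigma^{2j-1}_{n,r+1}=-\sigma^j_{n,r},\quad \sigma^{2j}_{n,r+1}=\sigma^j_{n,r},$$ $$\lambda^{2j-1}_{n,r+1}=\lambda^{2j}_{n,r+1}=\lambda^j_{n,r}\,(2m^j_{n,r}+1).$$ For example, for $r=2$ the indices are $n-2,n,n,n+2$, the signs are $+,-,-,+$, and the numbers $\lambda^j_{n,2}$ are $(2n+1)(2n-1)$ for $j=1,2$ and $(2n+1)(2n+3)$ for $j=3,4$. *)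

theory Defs
  imports "HOL-Analysis.Analysis"
begin

text \<open>
  Legendre polynomials, by Rodrigues' formula. The lemmas \<open>degree_legendre\<close>,
  \<open>poly_legendre_1\<close> and \<open>legendre_orthogonal\<close> below confirm that this is the
  orthogonal family on \<open>[-1, 1]\<close> with the normalization \<open>L\<^sub>m(1) = 1\<close>.
\<close>

definition legendre :: "nat \<Rightarrow> real poly" where
  "legendre m = smult (1 / (2 ^ m * fact m)) ((pderiv ^^ m) ([:-1, 0, 1:] ^ m))"

text \<open>Only meaningful for \<open>m \<ge> 1\<close>; the value at \<open>m = 0\<close> is division by zero.\<close>

definition cal_L :: "nat \<Rightarrow> real \<Rightarrow> real" where
  "cal_L m x = (1 - x\<^sup>2) * poly (pderiv (legendre m)) x / (real m * (real m + 1))"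

text \<open>
  The families \<open>m\<^sup>j\<^sub>n\<^sub>,\<^sub>r\<close>, \<open>\<sigma>\<^sup>j\<^sub>n\<^sub>,\<^sub>r\<close>, \<open>\<lambda>\<^sup>j\<^sub>n\<^sub>,\<^sub>r\<close> are totalized, and relevant only for
  \<open>r < n\<close> and \<open>1 \<le> j \<le> 2 ^ r\<close>; there the natural subtraction in \<open>idx\<close> does not truncate
  (see \<open>idx_ge\<close>). Both children \<open>2 * j - 1\<close> and \<open>2 * j\<close> of \<open>j\<close> are mapped back to
  \<open>j\<close> by \<open>(\<lambda>k. (k + 1) div 2)\<close>; the recursion over the parent index is spelled out in
  \<open>idx_children\<close>, \<open>sgn_coeff_children\<close> and \<open>lam_children\<close>.
\<close>

fun idx :: "nat \<Rightarrow> nat \<Rightarrow> nat \<Rightarrow> nat" where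
  "idx n 0 j = n"
| "idx n (Suc r) j =
     (if odd j then idx n r ((j + 1) div 2) - 1 else idx n r ((j + 1) div 2) + 1)"

fun sgn_coeff :: "nat \<Rightarrow> nat \<Rightarrow> nat \<Rightarrow> real" where
  "sgn_coeff n 0 j = 1"
| "sgn_coeff n (Suc r) j =
     (if odd j then - sgn_coeff n r ((j + 1) div 2) else sgn_coeff n r ((j + 1) div 2))"

fun lam :: "nat \<Rightarrow> nat \<Rightarrow> nat \<Rightarrow> real" where
  "lam n 0 j = 1"
| "lam n (Suc r) j = lam n r ((j + 1) div 2) * (2 * real (idx n r ((j + 1) div 2)) + 1)"

lemma idx_children:
  assumes "j \<ge> 1"
  shows "idx n (Suc r) (2 * j - 1) = idx n r j - 1" "idx n (Suc r) (2 * j) = idx n r j + 1"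
  using assms by auto

lemma sgn_coeff_children:
  assumes "j \<ge> 1"
  shows "sgn_coeff n (Suc r) (2 * j - 1) = - sgn_coeff n r j"
    "sgn_coeff n (Suc r) (2 * j) = sgn_coeff n r j"
  using assms by auto

lemma lam_children:
  assumes "j \<ge> 1"
  shows "lam n (Suc r) (2 * j - 1) = lam n r j * (2 * real (idx n r j) + 1)"
    "lam n (Suc r) (2 * j) = lam n r j * (2 * real (idx n r j) + 1)"
  using assms by auto

lemma idx_ge: "n - r \<le> idx n r j"
proof (induction r arbitrary: j)
  case (Suc r)
  show ?case using Suc.IH[of "(j + 1) div 2"] by auto
qed simp

lemma degree_legendre: "degree (legendre m) = m"
proof -
  have h: "degree ((pderiv ^^ k) p) = degree p - k" for k and p :: "real poly"
    by (induction k) (auto simp: degree_pderiv)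
  have "degree ([:-1, 0, 1:] ^ m :: real poly) = 2 * m"
    by (subst degree_power_eq) auto
  then show ?thesis by (simp add: legendre_def h)
qed

lemma poly_legendre_1: "poly (legendre m) 1 = 1"
proof -
  have h: "poly ((pderiv ^^ m) ([:-1, 1:] ^ m * f)) 1 = fact m * poly f 1" for f :: "real poly"
  proof (induction m arbitrary: f)
    case (Suc m)
    have "pderiv ([:-1, 1:] ^ Suc m * f) =
        [:-1, 1:] ^ m * (smult (real (Suc m)) f + [:-1, 1:] * pderiv f)"
      unfolding pderiv_mult pderiv_power_Suc by (simp add: pderiv_pCons algebra_simps)
    then have "poly ((pderiv ^^ Suc m) ([:-1, 1:] ^ Suc m * f)) 1 =
        fact m * poly (smult (real (Suc m)) f + [:-1, 1:] * pderiv f) 1"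
      unfolding funpow_Suc_right o_apply by (simp only: Suc.IH)
    then show ?case by (simp add: algebra_simps)
  qed simp
  have "[:-1, 0, 1:] ^ m = [:-1, 1:] ^ m * ([:1, 1:] ^ m :: real poly)"
    by (simp flip: power_mult_distrib)
  then have "poly ((pderiv ^^ m) ([:-1, 0, 1:] ^ m)) (1::real) = fact m * 2 ^ m"
    by (simp add: h)
  then show ?thesis by (simp add: legendre_def)
qed

lemma legendre_orthogonal:
  assumes "degree q < m"
  shows "((\<lambda>x. poly (legendre m) x * poly q x) has_integral 0) {-1..1}"
proof -
  define W :: "real poly" where "W = [:-1, 0, 1:] ^ m"
  have dvd: "p ^ (m - k) dvd (pderiv ^^ k) (p ^ m)" if "k \<le> m" for k and p :: "real poly"
    using that
  proof (induction k)
    case (Suc k)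
    then obtain g where g: "(pderiv ^^ k) (p ^ m) = p ^ Suc (m - Suc k) * g"
      by (metis Suc_diff_Suc Suc_leD Suc_le_lessD dvdE)
    have "pderiv (p ^ Suc (m - Suc k) * g) =
        p ^ (m - Suc k) * (p * pderiv g + smult (of_nat (Suc (m - Suc k))) (pderiv p * g))"
      unfolding pderiv_mult pderiv_power_Suc by (simp add: algebra_simps)
    then show ?case by (simp add: g)
  qed simp
  have boundary: "poly ((pderiv ^^ k) W) x = 0" if "k < m" "x\<^sup>2 = 1" for k x
  proof -
    from dvd[of k "[:-1, 0, 1:]"] that obtain g
      where "(pderiv ^^ k) W = [:-1, 0, 1:] ^ (m - k) * g"
      unfolding W_def by (auto elim: dvdE)
    with that show ?thesis by (simp add: power2_eq_square)
  qed
  have "((\<lambda>x. poly ((pderiv ^^ j) W) x * poly p x) has_integral 0) {-1..1}"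
    if "j \<le> m" "degree p < j" for j p
    using that
  proof (induction j arbitrary: p)
    case (Suc j)
    let ?D = "(pderiv ^^ j) W"
    have "((\<lambda>x. poly (pderiv (?D * p)) x) has_integral poly (?D * p) 1 - poly (?D * p) (-1)) {-1..1}"
    proof (rule fundamental_theorem_of_calculus)
      fix x :: real
      show "(poly (?D * p) has_vector_derivative poly (pderiv (?D * p)) x) (at x within {-1..1})"
        using poly_DERIV[of "?D * p" x]
        by (metis has_field_derivative_at_within has_real_derivative_iff_has_vector_derivative)
    qed simp
    moreover have "poly (?D * p) 1 - poly (?D * p) (-1) = 0"
      using Suc.prems boundary[of j] by simp
    ultimately have 1: "((\<lambda>x. poly (pderiv (?D * p)) x) has_integral 0) {-1..1}" by simp
    have 2: "((\<lambda>x. poly ?D x * poly (pderiv p) x) has_integral 0) {-1..1}"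
    proof (cases "degree p = 0")
      case True
      then have "pderiv p = 0" by (simp add: pderiv_eq_0_iff)
      then show ?thesis by simp
    next
      case False
      then show ?thesis using Suc.prems by (intro Suc.IH) (auto simp: degree_pderiv)
    qed
    from has_integral_diff[OF 1 2] show ?case
      by (simp add: pderiv_mult algebra_simps)
  qed simp
  from has_integral_mult_right[OF this[of m q], of "1 / (2 ^ m * fact m)"] assms
  show ?thesis by (simp add: legendre_def W_def mult.assoc)
qed

end

theory Submission
  imports Defs
begin

text \<open>
  Everything rests on one identity: for \<open>m \<ge> 2\<close>,
  \<open>(2 m + 1) \<L>\<^sub>m = (\<L>\<^bsub>m+1\<^esub> - \<L>\<^bsub>m-1\<^esub>)'\<close>, where \<open>\<L>\<^sub>m = cal_L m\<close> (\<open>pderiv_cal_L_poly_diff\<close>).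
  It comes from two classical properties of Legendre polynomials. The Legendre differential
  equation says \<open>\<L>\<^sub>m' = - L\<^sub>m\<close>, so the right-hand side is \<open>L\<^bsub>m-1\<^esub> - L\<^bsub>m+1\<^esub>\<close>. The recurrence
  \<open>L\<^bsub>m+1\<^esub>' - L\<^bsub>m-1\<^esub>' = (2 m + 1) L\<^sub>m\<close> then shows that both sides have the same derivative, and both
  vanish at \<open>1\<close>. The two properties are read off from Rodrigues' formula by differentiating
  powers of \<open>u = x\<^sup>2 - 1\<close>.

  Replacing \<open>\<L>\<^sub>m\<close> by \<open>((\<L>\<^bsub>m+1\<^esub> - \<L>\<^bsub>m-1\<^esub>) / (2 m + 1))'\<close> is exactly one step of the binary
  recursion for indices, signs and denominators: a summand splits into the two summands of its
  children (\<open>pderiv_level_sum\<close>). Starting from \<open>\<L>\<^sub>n\<close> and iterating \<open>r\<close> times gives the expansion; all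
  indices that get split are at least \<open>n - (r - 1) \<ge> 2\<close>, so \<open>\<L>\<^sub>0\<close> never occurs.

  The explicit denominators belong to the outermost branches of the tree, on which the index
  decreases or increases by one at each step. The bounds hold because the index at depth \<open>r\<close> lies
  between \<open>n - r\<close> and \<open>n + r\<close>, so that each factor of a denominator lies between the
  corresponding factors of the two outermost ones.
\<close>

section \<open>The Legendre differential equation and the derivative recurrence\<close>

text \<open>
  The Leibniz rule stops after two or three terms when one factor is \<open>x\<close> or \<open>x\<^sup>2 - 1\<close>. The truncated
  subtraction is harmless: the coefficient vanishes where it would matter.
\<close>

lemma higher_pderiv_X_mult:
  fixes p :: "real poly"
  shows "(pderiv ^^ k) ([:0, 1:] * p) =
    [:0, 1:] * (pderiv ^^ k) p + smult (real k) ((pderiv ^^ (k - 1)) p)"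
proof (induction k)
  case (Suc k)
  have "smult (real k) (pderiv ((pderiv ^^ (k - 1)) p)) = smult (real k) ((pderiv ^^ k) p)"
    by (cases k) simp_all
  with Suc.IH show ?case
    by (simp add: pderiv_add pderiv_smult pderiv_mult pderiv_pCons algebra_simps smult_add_left)
qed simp

lemma higher_pderiv_X2_minus_1_mult:
  fixes p :: "real poly"
  shows "(pderiv ^^ Suc k) ([:-1, 0, 1:] * p) =
    [:-1, 0, 1:] * (pderiv ^^ Suc k) p + smult (2 * real (Suc k)) ([:0, 1:] * (pderiv ^^ k) p)
    + smult (real (Suc k) * real k) ((pderiv ^^ (k - 1)) p)"
proof -
  have "[:-1, 0, 1:] * p = [:0, 1:] * ([:0, 1:] * p) + smult (-1) p"
    by (simp add: algebra_simps)
  then have "(pderiv ^^ Suc k) ([:-1, 0, 1:] * p) =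
      [:0, 1:] * ([:0, 1:] * (pderiv ^^ Suc k) p + smult (real (Suc k)) ((pderiv ^^ k) p))
      + smult (real (Suc k)) ([:0, 1:] * (pderiv ^^ k) p + smult (real k) ((pderiv ^^ (k - 1)) p))
      + smult (-1) ((pderiv ^^ Suc k) p)"
    by (simp only: higher_pderiv_add higher_pderiv_smult higher_pderiv_X_mult diff_Suc_1)
  then show ?thesis
    by (simp only: poly_eq_poly_eq_iff[symmetric] fun_eq_iff) (simp add: algebra_simps)
qed

text \<open>
  The power \<open>w = u\<^sup>m\<close> satisfies \<open>u w' = 2 m x w\<close>; differentiating this \<open>m + 1\<close> times by the Leibniz
  rule gives the Legendre equation for the \<open>m\<close>-th derivative of \<open>w\<close>.
\<close>

lemma legendre_ode:
  "pderiv ([:1, 0, -1:] * pderiv (legendre m)) =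
    smult (- (real m * (real m + 1))) (legendre m)"
proof -
  define w :: "real poly" where "w = [:-1, 0, 1:] ^ m"
  have first_order: "[:-1, 0, 1:] * pderiv w = smult (2 * real m) ([:0, 1:] * w)"
  proof (cases m)
    case 0
    then show ?thesis by (simp add: w_def)
  next
    case (Suc k)
    have deriv_w: "pderiv w = smult (real (Suc k)) ([:-1, 0, 1:] ^ k) * [:0, 2:]"
      unfolding w_def Suc pderiv_power_Suc by (simp add: pderiv_pCons)
    have w: "w = [:-1, 0, 1:] * [:-1, 0, 1:] ^ k"
      by (simp only: w_def Suc power_Suc)
    show ?thesis
      unfolding deriv_w unfolding w Suc
      by (simp only: poly_eq_poly_eq_iff[symmetric] fun_eq_iff) (simp add: algebra_simps)
  qed
  have shift: "(pderiv ^^ k) (pderiv w) = (pderiv ^^ Suc k) w" for k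
    by (simp add: funpow_swap1)
  define y where "y = (pderiv ^^ m) w"
  have low: "smult (real m) ((pderiv ^^ Suc (m - 1)) w) = smult (real m) y"
    by (cases m) (simp_all add: y_def)
  have D: "(pderiv ^^ Suc m) w = pderiv y" "(pderiv ^^ Suc (Suc m)) w = pderiv (pderiv y)"
    by (simp_all add: y_def)
  have "(pderiv ^^ Suc m) ([:-1, 0, 1:] * pderiv w) =
      (pderiv ^^ Suc m) (smult (2 * real m) ([:0, 1:] * w))"
    by (simp only: first_order)
  then have "[:-1, 0, 1:] * pderiv (pderiv y) + smult (2 * real (Suc m)) ([:0, 1:] * pderiv y)
      + smult (real (Suc m)) (smult (real m) y) =
      smult (2 * real m) ([:0, 1:] * pderiv y + smult (real (Suc m)) y)"
    by (simp only: higher_pderiv_X2_minus_1_mult higher_pderiv_smult higher_pderiv_X_mult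
      smult_smult[symmetric] low shift D diff_Suc_1 y_def[symmetric])
  then have "pderiv ([:1, 0, -1:] * pderiv y) = smult (- (real m * (real m + 1))) y"
    by (simp only: pderiv_mult poly_eq_poly_eq_iff[symmetric] fun_eq_iff)
      (simp add: pderiv_pCons algebra_simps)
  moreover have "legendre m = smult (1 / (2 ^ m * fact m)) y"
    by (simp add: legendre_def y_def w_def)
  ultimately show ?thesis
    by (simp add: pderiv_smult mult.commute)
qed

text \<open>
  With \<open>m = k + 1\<close>, the second derivative of \<open>u\<^bsup>m+1\<^esup>\<close> is
  \<open>2 (m + 1) ((2 m + 1) u\<^bsup>m\<^esup> + 2 m u\<^bsup>m-1\<^esup>)\<close>, because \<open>x\<^sup>2 = u + 1\<close>. Differentiating \<open>m\<close> more times turns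
  the three powers into multiples of \<open>L\<^bsub>m+1\<^esub>'\<close>, \<open>L\<^sub>m\<close> and \<open>L\<^bsub>m-1\<^esub>'\<close>.
\<close>

lemma pderiv_legendre_diff:
  "pderiv (legendre (Suc (Suc k))) - pderiv (legendre k) =
    smult (2 * real (Suc k) + 1) (legendre (Suc k))"
proof -
  define u :: "real poly" where "u = [:-1, 0, 1:]"
  define c :: real where "c = 1 / (2 ^ k * fact k)"
  have second_pderiv: "pderiv (pderiv (u ^ Suc (Suc k))) =
      smult (2 * real (k + 2)) (smult (2 * real (Suc k) + 1) (u ^ Suc k) + smult (2 * real (k + 1)) (u ^ k))"
    unfolding pderiv_power_Suc
    by (simp only: pderiv_mult pderiv_smult pderiv_power_Suc poly_eq_poly_eq_iff[symmetric] fun_eq_iff)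
      (simp add: u_def pderiv_pCons, simp add: algebra_simps)
  have "pderiv ((pderiv ^^ Suc (Suc k)) (u ^ Suc (Suc k)))
      = (pderiv ^^ Suc k) (pderiv (pderiv (u ^ Suc (Suc k))))"
    by (simp add: funpow_swap1 del: power_Suc)
  then have higher_pderiv_power: "pderiv ((pderiv ^^ Suc (Suc k)) (u ^ Suc (Suc k))) =
      smult (2 * real (k + 2)) (smult (2 * real (Suc k) + 1) ((pderiv ^^ Suc k) (u ^ Suc k))
        + smult (2 * real (k + 1)) (pderiv ((pderiv ^^ k) (u ^ k))))"
    by (simp only: second_pderiv higher_pderiv_add higher_pderiv_smult funpow.simps o_apply
      pderiv_add pderiv_smult)
  have rodrigues:
    "legendre k = smult c ((pderiv ^^ k) (u ^ k))"
    "legendre (Suc k) = smult (c / (2 * real (k + 1))) ((pderiv ^^ Suc k) (u ^ Suc k))"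
    "legendre (Suc (Suc k)) = smult (c / (2 * real (k + 1)) / (2 * real (k + 2)))
      ((pderiv ^^ Suc (Suc k)) (u ^ Suc (Suc k)))"
    unfolding legendre_def c_def u_def by (simp_all add: field_simps del: funpow.simps)
  have normalize: "smult (c / a / b) (smult b (smult d p + smult a q)) - smult c q =
      smult d (smult (c / a) p)" if "a \<noteq> 0" "b \<noteq> 0" for a b d and p q :: "real poly"
    using that by (simp add: smult_add_right mult.commute)
  show ?thesis
    unfolding rodrigues pderiv_smult higher_pderiv_power
    by (rule normalize) simp_all
qed

section \<open>One step of the expansion\<close>

definition cal_L_poly :: "nat \<Rightarrow> real poly" where
  "cal_L_poly m = smult (1 / (real m * (real m + 1))) ([:1, 0, -1:] * pderiv (legendre m))"

lemma poly_cal_L_poly: "poly (cal_L_poly m) x = cal_L m x"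
  unfolding cal_L_poly_def cal_L_def poly_smult poly_mult by (simp add: power2_eq_square)

lemma pderiv_cal_L_poly: "m \<ge> 1 \<Longrightarrow> pderiv (cal_L_poly m) = - legendre m"
  unfolding cal_L_poly_def pderiv_smult legendre_ode by simp

text \<open>
  With \<open>m = k + 1\<close>, both sides have derivative \<open>-(2 m + 1) L\<^sub>m\<close>, so they differ by a constant. The factor
  \<open>1 - x\<^sup>2\<close> and the normalization of the Legendre polynomials at \<open>1\<close> make both vanish at \<open>1\<close>.
\<close>

lemma cal_L_poly_eq_legendre_diff:
  "smult (2 * real (Suc k) + 1) (cal_L_poly (Suc k)) = legendre k - legendre (Suc (Suc k))"
proof -
  let ?d = "smult (2 * real (Suc k) + 1) (cal_L_poly (Suc k)) - (legendre k - legendre (Suc (Suc k)))"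
  have "pderiv ?d = 0"
    by (simp only: pderiv_diff pderiv_smult pderiv_cal_L_poly smult_minus_right
      pderiv_legendre_diff[symmetric])
  then obtain c where c: "?d = [:c:]"
    using pderiv_iszero by blast
  have "poly ?d 1 = 0"
    by (simp add: cal_L_poly_def poly_legendre_1)
  with c have "?d = 0" by simp
  then show ?thesis by simp
qed

lemma pderiv_cal_L_poly_diff:
  assumes "m \<ge> 2"
  shows "pderiv (cal_L_poly (m + 1) - cal_L_poly (m - 1)) = smult (2 * real m + 1) (cal_L_poly m)"
proof -
  obtain k where "m = Suc k" "k \<ge> 1"
    using assms by (cases m) auto
  then show ?thesis
    by (simp only: cal_L_poly_eq_legendre_diff) (simp add: pderiv_diff pderiv_cal_L_poly)
qed

section \<open>Iterating the expansion along the binary tree\<close>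

lemma idx_le: "idx n r j \<le> n + r"
proof (induction r arbitrary: j)
  case (Suc r)
  show ?case using Suc.IH[of "(j + 1) div 2"] by auto
qed simp

lemma lam_pos: "lam n r j > 0"
  by (induction r arbitrary: j) (auto intro!: mult_pos_pos add_nonneg_pos)

definition level_sum :: "nat \<Rightarrow> nat \<Rightarrow> real poly" where
  "level_sum n r = (\<Sum>j=1..2^r. smult (sgn_coeff n r j / lam n r j) (cal_L_poly (idx n r j)))"

lemma sum_pair_children:
  fixes f :: "nat \<Rightarrow> 'a::comm_monoid_add"
  shows "(\<Sum>j=1..2 * N. f j) = (\<Sum>j=1..N. f (2 * j - 1) + f (2 * j))"
  by (induction N) (simp_all add: add.assoc)

lemma pderiv_sum: "pderiv (sum f A) = (\<Sum>x\<in>A. pderiv (f x))"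
  using higher_pderiv_sum[of 1 f A] by simp

text \<open>
  The two children of a node have opposite signs, a common denominator and neighbouring indices
  \<open>m - 1\<close> and \<open>m + 1\<close>, so the derivative of their joint contribution is the contribution of the node.
\<close>

lemma pderiv_level_sum:
  assumes "r + 2 \<le> n"
  shows "pderiv (level_sum n (Suc r)) = level_sum n r"
proof -
  let ?t = "\<lambda>r j. smult (sgn_coeff n r j / lam n r j) (cal_L_poly (idx n r j))"
  have "pderiv (?t (Suc r) (2 * j - 1) + ?t (Suc r) (2 * j)) = ?t r j" if "j \<in> {1..2 ^ r}" for j
  proof -
    let ?m = "idx n r j"
    let ?a = "sgn_coeff n r j / (lam n r j * (2 * real ?m + 1))"
    have j: "j \<ge> 1" using that by simp
    have m: "?m \<ge> 2" using idx_ge[of n r j] assms by linarith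
    have "?t (Suc r) (2 * j - 1) + ?t (Suc r) (2 * j) =
        smult ?a (cal_L_poly (?m + 1) - cal_L_poly (?m - 1))"
      unfolding idx_children[OF j] sgn_coeff_children[OF j] lam_children[OF j]
      by (simp add: smult_diff_right)
    then have "pderiv (?t (Suc r) (2 * j - 1) + ?t (Suc r) (2 * j)) =
        smult (?a * (2 * real ?m + 1)) (cal_L_poly ?m)"
      by (simp only: pderiv_smult pderiv_cal_L_poly_diff[OF m] smult_smult)
    also have "?a * (2 * real ?m + 1) = sgn_coeff n r j / lam n r j"
      using of_nat_0_le_iff[of ?m, where ?'a = real] by simp
    finally show ?thesis .
  qed
  then show ?thesis
    unfolding level_sum_def power_Suc sum_pair_children pderiv_sum
    by (intro sum.cong) simp_all
qed

lemma higher_pderiv_level_sum: "r + 1 \<le> n \<Longrightarrow> (pderiv ^^ r) (level_sum n r) = cal_L_poly n"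
proof (induction r)
  case 0
  show ?case by (simp add: level_sum_def)
next
  case (Suc r)
  then have "(pderiv ^^ Suc r) (level_sum n (Suc r)) = (pderiv ^^ r) (level_sum n r)"
    by (simp add: funpow_swap1 pderiv_level_sum)
  with Suc show ?case by simp
qed

lemma funpow_deriv_poly: "(deriv ^^ k) (poly p) = poly ((pderiv ^^ k) p)" for p :: "real poly"
proof (induction k)
  case (Suc k)
  have "deriv (poly q) = poly (pderiv q)" for q :: "real poly"
    by (rule ext) (simp add: DERIV_imp_deriv)
  with Suc show ?case by simp
qed simp

lemma cal_L_eq_higher_deriv:
  assumes "r + 1 \<le> n"
  shows "cal_L n x =
    (deriv ^^ r) (\<lambda>t. \<Sum>j=1..2^r. sgn_coeff n r j * cal_L (idx n r j) t / lam n r j) x"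
proof -
  have "(\<lambda>t. \<Sum>j=1..2^r. sgn_coeff n r j * cal_L (idx n r j) t / lam n r j) = poly (level_sum n r)"
    by (rule ext) (simp add: level_sum_def poly_sum poly_cal_L_poly)
  then show ?thesis
    by (simp add: funpow_deriv_poly higher_pderiv_level_sum[OF assms] poly_cal_L_poly)
qed

section \<open>The outermost branches\<close>

lemma first_branch:
  "idx n r 1 = n - r" "sgn_coeff n r 1 = (-1) ^ r"
  "r \<le> n \<Longrightarrow> lam n r 1 = (\<Prod>i=1..r. 2 * real n - 2 * real i + 3)"
proof -
  show idx: "idx n r 1 = n - r" for r by (induction r) simp_all
  show "sgn_coeff n r 1 = (-1) ^ r" by (induction r) simp_all
  show "r \<le> n \<Longrightarrow> lam n r 1 = (\<Prod>i=1..r. 2 * real n - 2 * real i + 3)"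
  proof (induction r)
    case (Suc r)
    with idx[of r] show ?case by (simp add: of_nat_diff algebra_simps)
  qed simp
qed

lemma last_branch:
  "idx n r (2 ^ r) = n + r" "sgn_coeff n r (2 ^ r) = 1"
  "lam n r (2 ^ r) = (\<Prod>i=1..r. 2 * real n + 2 * real i - 1)"
proof -
  show idx: "idx n r (2 ^ r) = n + r" for r by (induction r) simp_all
  show "sgn_coeff n r (2 ^ r) = 1" by (induction r) simp_all
  show "lam n r (2 ^ r) = (\<Prod>i=1..r. 2 * real n + 2 * real i - 1)"
  proof (induction r)
    case (Suc r)
    with idx[of r] show ?case by (simp add: algebra_simps)
  qed simp
qed

lemma lam_bounds: "lam n r 1 \<le> lam n r j" "lam n r j \<le> lam n r (2 ^ r)"
proof -
  show "lam n r 1 \<le> lam n r j"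
  proof (induction r arbitrary: j)
    case (Suc r)
    let ?p = "(j + 1) div 2"
    have "lam n r 1 * (2 * real (idx n r 1) + 1) \<le> lam n r ?p * (2 * real (idx n r ?p) + 1)"
      using Suc.IH[of ?p] idx_ge[of n r ?p] less_imp_le[OF lam_pos]
      unfolding first_branch(1) by (intro mult_mono) simp_all
    then show ?case by simp
  qed simp
  show "lam n r j \<le> lam n r (2 ^ r)"
  proof (induction r arbitrary: j)
    case (Suc r)
    let ?p = "(j + 1) div 2"
    have "lam n r ?p * (2 * real (idx n r ?p) + 1) \<le>
        lam n r (2 ^ r) * (2 * real (idx n r (2 ^ r)) + 1)"
      using Suc.IH[of ?p] idx_le[of n r ?p] less_imp_le[OF lam_pos]
      unfolding last_branch(1) by (intro mult_mono) simp_all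
    then show ?case by simp
  qed simp
qed

theorem lemma1:
  fixes n r :: nat
  assumes "1 \<le> r" and "r \<le> n - 1"
  shows
    "(\<forall>x. cal_L n x =
        (deriv ^^ r) (\<lambda>t. \<Sum>j=1..2^r. sgn_coeff n r j * cal_L (idx n r j) t / lam n r j) x)
   \<and> (r = 1 \<longrightarrow> (\<forall>x. cal_L n x =
        (deriv ^^ r) (\<lambda>t.
            (-1)^r * cal_L (n - r) t / lam n r 1
          + cal_L (n + r) t / lam n r (2^r)) x))
   \<and> (2 \<le> r \<longrightarrow> (\<forall>x. cal_L n x =
        (deriv ^^ r) (\<lambda>t.
            (-1)^r * cal_L (n - r) t / lam n r 1
          + (-1)^(r - 1) * cal_L (n - r + 2) t / lam n r 2
          + (\<Sum>j=3..2^r - 2. sgn_coeff n r j * cal_L (idx n r j) t / lam n r j)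
          - cal_L (n + r - 2) t / lam n r (2^r - 1)
          + cal_L (n + r) t / lam n r (2^r)) x))
   \<and> sgn_coeff n r 1 = (-1)^r \<and> idx n r 1 = n - r
   \<and> sgn_coeff n r 2 = (-1)^(r - 1) \<and> idx n r 2 = n - r + 2
   \<and> sgn_coeff n r (2^r - 1) = -1 \<and> idx n r (2^r - 1) = n + r - 2
   \<and> sgn_coeff n r (2^r) = 1 \<and> idx n r (2^r) = n + r
   \<and> (\<forall>j\<in>{1, 2}. lam n r j = (\<Prod>i=1..r. 2 * real n - 2 * real i + 3))
   \<and> (\<forall>j\<in>{2^r - 1, 2^r}. lam n r j = (\<Prod>i=1..r. 2 * real n + 2 * real i - 1))
   \<and> (\<forall>j\<in>{1..2^(r - 1)}.
          lam n r 1 = lam n r 2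
        \<and> lam n r 2 \<le> lam n r (2 * j - 1)
        \<and> lam n r (2 * j - 1) = lam n r (2 * j)
        \<and> lam n r (2 * j) \<le> lam n r (2^r - 1)
        \<and> lam n r (2^r - 1) = lam n r (2^r))"
proof -
  obtain s where r: "r = Suc s"
    using assms(1) by (cases r) auto
  have rn: "r + 1 \<le> n" and sn: "s + 2 \<le> n"
    using assms r by linarith+
  let ?T = "\<lambda>t j. sgn_coeff n r j * cal_L (idx n r j) t / lam n r j"
  have expansion: "cal_L n x = (deriv ^^ r) (\<lambda>t. \<Sum>j=1..2^r. ?T t j) x" for x
    by (rule cal_L_eq_higher_deriv[OF rn])
  have first: "sgn_coeff n r 1 = (-1)^r" "idx n r 1 = n - r"
    "lam n r 1 = (\<Prod>i=1..r. 2 * real n - 2 * real i + 3)"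
    using first_branch[where n = n and r = r] rn by simp_all
  have last: "sgn_coeff n r (2^r) = 1" "idx n r (2^r) = n + r"
    "lam n r (2^r) = (\<Prod>i=1..r. 2 * real n + 2 * real i - 1)"
    using last_branch[where n = n and r = r] by simp_all
  have siblings: "lam n r (2 * j - 1) = lam n r (2 * j)" if "j \<ge> 1" for j
    using lam_children[OF that] r by simp
  \<comment> \<open>The second and the last but one node are the siblings of the outermost ones.\<close>
  have second: "sgn_coeff n r 2 = (-1)^(r - 1)" "idx n r 2 = n - r + 2" "lam n r 2 = lam n r 1"
    using sgn_coeff_children(2)[of 1 n s] idx_children(2)[of 1 n s] siblings[of 1]
      first_branch[where n = n and r = s] r sn by simp_all
  have penultimate: "sgn_coeff n r (2^r - 1) = -1" "idx n r (2^r - 1) = n + r - 2"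
    "lam n r (2^r - 1) = lam n r (2^r)"
    using sgn_coeff_children(1)[of "2^s" n s] idx_children(1)[of "2^s" n s] siblings[of "2^s"]
      last_branch[where n = n and r = s] r by simp_all
  have split1: "(\<Sum>j=1..2^r. ?T t j) =
      (-1)^r * cal_L (n - r) t / lam n r 1 + cal_L (n + r) t / lam n r (2^r)" if "r = 1" for t
  proof -
    have "{1..2^r} = {1, 2^r :: nat}" using that by auto
    then have "(\<Sum>j=1..2^r. ?T t j) = ?T t 1 + ?T t (2^r)" using that by simp
    then show ?thesis by (simp only: first(1,2) last(1,2) mult_1)
  qed
  have split2: "(\<Sum>j=1..2^r. ?T t j) =
      (-1)^r * cal_L (n - r) t / lam n r 1
      + (-1)^(r - 1) * cal_L (n - r + 2) t / lam n r 2
      + (\<Sum>j=3..2^r - 2. ?T t j)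
      - cal_L (n + r - 2) t / lam n r (2^r - 1)
      + cal_L (n + r) t / lam n r (2^r)" if "2 \<le> r" for t
  proof -
    have "(2::nat)^2 \<le> 2^r" using that by (intro power_increasing) auto
    moreover define N :: nat where "N = 2^r"
    ultimately have N: "4 \<le> N" by simp
    have "{1..N} = {1, 2} \<union> ({3..N - 2} \<union> {N - 1, N})"
      using N by auto
    then have "(\<Sum>j=1..N. ?T t j) = (\<Sum>j\<in>{1, 2} \<union> ({3..N - 2} \<union> {N - 1, N}). ?T t j)"
      by simp
    also have "\<dots> = (\<Sum>j\<in>{1, 2}. ?T t j) + ((\<Sum>j=3..N - 2. ?T t j) + (\<Sum>j\<in>{N - 1, N}. ?T t j))"
      using N by (subst sum.union_disjoint; (subst sum.union_disjoint)?) auto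
    also have "\<dots> = ?T t 1 + ?T t 2 + (\<Sum>j=3..N - 2. ?T t j) + ?T t (N - 1) + ?T t N"
      using N by (simp add: algebra_simps)
    finally show ?thesis
      unfolding N_def by (simp only: first(1,2) second(1,2) penultimate(1,2) last(1,2))
  qed
  show ?thesis
  proof (intro conjI allI impI ballI)
    fix x
    show "cal_L n x = (deriv ^^ r) (\<lambda>t. \<Sum>j=1..2^r. ?T t j) x"
      by (rule expansion)
  next
    fix x
    assume "r = 1"
    show "cal_L n x = (deriv ^^ r) (\<lambda>t.
        (-1)^r * cal_L (n - r) t / lam n r 1 + cal_L (n + r) t / lam n r (2^r)) x"
      using expansion[of x] unfolding split1[OF \<open>r = 1\<close>] .
  next
    fix x
    assume "2 \<le> r"
    show "cal_L n x = (deriv ^^ r) (\<lambda>t.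
        (-1)^r * cal_L (n - r) t / lam n r 1
        + (-1)^(r - 1) * cal_L (n - r + 2) t / lam n r 2
        + (\<Sum>j=3..2^r - 2. ?T t j)
        - cal_L (n + r - 2) t / lam n r (2^r - 1)
        + cal_L (n + r) t / lam n r (2^r)) x"
      using expansion[of x] unfolding split2[OF \<open>2 \<le> r\<close>] .
  next
    fix j :: nat
    assume "j \<in> {1, 2}"
    then show "lam n r j = (\<Prod>i=1..r. 2 * real n - 2 * real i + 3)"
      using first(3) second(3) by auto
  next
    fix j :: nat
    assume "j \<in> {2^r - 1, 2^r}"
    then show "lam n r j = (\<Prod>i=1..r. 2 * real n + 2 * real i - 1)"
      using last(3) penultimate(3) by auto
  next
    fix j :: nat
    assume "j \<in> {1..2^(r - 1)}"
    then show "lam n r (2 * j - 1) = lam n r (2 * j)"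
      by (intro siblings) simp
  qed (use first second penultimate last lam_bounds[of n r] in simp_all)
qed

end
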